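(* For every $Q\in\mathbb{R}^n$ there exists a $Q$-minimax measure $\mu=\theta\pi$, $\pi\in\Pi(\theta,Q)$; that is, there exist a Borel probability measure $\theta$ on $\mathbb{T}^n$ and $\pi\in\Pi(\theta,Q)$ such that, with $\mu=\theta\pi$: (1) $\int L\,d\mu\le \int L\,d(\theta\tilde\pi)$ for all $\tilde\pi\in\Pi(\theta,Q)$; (2) for any Borel probability measure $\tilde\theta$ on $\mathbb{T}^n$, $\int L\,d\mu\ge \inf_{\tilde\pi\in\Pi(\tilde\theta,Q)}\int L\,d(\tilde\theta\tilde\pi)$.
   Context: $\mathbb{T}^n$ is the $n$-torus $\mathbb{R}^n/\mathbb{Z}^n$; $x+v\in\mathbb{T}^n$ for $x\in\mathbb{T}^n$, $v\in\mathbb{R}^n$ is taken mod $\mathbb{Z}^n$. The Lagrangian $L:\mathbb{T}^n\times\mathbb{R}^n\to\mathbb{R}$ is smooth, strictly convex in $v$ with $D^2_{vv}L(x,v)\ge\gamma>0$ for some constant $\gamma$, coercive: $\lim_{|v|\to\infty}L(x,v)/|v|=\infty$, and satisfies $|D_xL(x,v)|\le C$ and $|D^2_{xx}L(x,v)|\le C$ for some constant $C$. For a Borel probability measure $\theta$ on $\mathbb{T}^n$ and $Q\in\mathbb{R}^n$, $\Pi(\theta,Q)$ is the set of plans $\pi$, i.e. (measurable) families $\pi(x,dv)$, $x\in\mathbb{T}^n$, of Borel probability measures on $\mathbb{R}^n$, such that $\int \phi(x+v)\,\pi(x,dv)\,\theta(dx)=\int\phi(x)\,\theta(dx)$ for all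 continuous $\phi:\mathbb{T}^n\to\mathbb{R}$, and $\int v\,\pi(x,dv)\,\theta(dx)=Q$. The measure $\theta\pi$ on $\mathbb{T}^n\times\mathbb{R}^n$ is $\theta(dx)\pi(x,dv)$. *)

theory Defs
  imports "HOL-Probability.Probability"
begin

definition torus_rel :: "real^'n \<Rightarrow> real^'n \<Rightarrow> bool" where
  "torus_rel x y \<longleftrightarrow> (\<forall>i. x $ i - y $ i \<in> \<int>)"

lemma equivp_torus_rel: "equivp torus_rel"
proof (rule equivpI)
  show "reflp torus_rel"
    by (simp add: reflp_def torus_rel_def)
  show "symp torus_rel"
    unfolding symp_def torus_rel_def by (metis Ints_minus minus_diff_eq)
  show "transp torus_rel"
    unfolding transp_def torus_rel_def
  proof (intro allI impI)
    fix x y z :: "real^'n" and i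
    assume "\<forall>i. x $ i - y $ i \<in> \<int>" and "\<forall>i. y $ i - z $ i \<in> \<int>"
    then have "(x $ i - y $ i) + (y $ i - z $ i) \<in> \<int>"
      by (intro Ints_add) auto
    then show "x $ i - z $ i \<in> \<int>" by simp
  qed
qed

quotient_type 'n torus = "real^'n" / torus_rel
  by (rule equivp_torus_rel)

definition torus_proj :: "real^'n \<Rightarrow> 'n torus" where
  "torus_proj = abs_torus"

instantiation torus :: (finite) topological_space
begin

definition open_torus :: "'a torus set \<Rightarrow> bool" where
  "open_torus U \<longleftrightarrow> open (torus_proj -` U)"

instance
proof
  show "open (UNIV :: 'a torus set)"
    by (simp add: open_torus_def)
  show "open (S \<inter> T)" if "open S" "open T" for S T :: "'a torus set"
    using that by (simp add: open_torus_def open_Int)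
  show "open (\<Union>K)" if "\<forall>S\<in>K. open S" for K :: "'a torus set set"
    using that by (auto simp add: open_torus_def vimage_Union)
qed

end

lift_definition torus_translate :: "'n::finite torus \<Rightarrow> real^'n \<Rightarrow> 'n torus"  (infixl "\<oplus>\<^sub>T" 65)
  is "\<lambda>x v. x + v"
  by (simp add: torus_rel_def)

primrec C_k :: "nat \<Rightarrow> ('a::real_normed_vector \<Rightarrow> 'b::real_normed_vector) \<Rightarrow> bool" where
  "C_k 0 f \<longleftrightarrow> continuous_on UNIV f"
| "C_k (Suc k) f \<longleftrightarrow> (\<forall>x. f differentiable (at x)) \<and>
     (\<forall>h. C_k k (\<lambda>x. frechet_derivative f (at x) h))"

definition smooth :: "('a::real_normed_vector \<Rightarrow> 'b::real_normed_vector) \<Rightarrow> bool" where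
  "smooth f \<longleftrightarrow> (\<forall>k. C_k k f)"

definition second_derivative ::
    "('a::real_normed_vector \<Rightarrow> 'b::real_normed_vector) \<Rightarrow> 'a \<Rightarrow> 'a \<Rightarrow> 'a \<Rightarrow> 'b" where
  "second_derivative f x h k =
     frechet_derivative (\<lambda>y. frechet_derivative f (at y) h) (at x) k"

text \<open>
  Smoothness and the derivatives in \<open>x\<close> of a function on the product of the torus and
  \<open>real^'n\<close> are those of its periodic lift; this is the usual notion, as the projection is a
  local diffeomorphism.
\<close>

definition lift_lagrangian :: "('n::finite torus \<Rightarrow> real^'n \<Rightarrow> real) \<Rightarrow> real^'n \<Rightarrow> real^'n \<Rightarrow> real" where
  "lift_lagrangian L x v = L (torus_proj x) v"

text \<open>The measure \<open>\<theta>(dx) \<pi>(x,dv)\<close>.\<close>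

definition plan_measure ::
    "'n::finite torus measure \<Rightarrow> ('n torus \<Rightarrow> (real^'n) measure) \<Rightarrow> ('n torus \<times> (real^'n)) measure" where
  "plan_measure \<theta> \<pi> = \<theta> \<bind> (\<lambda>x. distr (\<pi> x) (borel \<Otimes>\<^sub>M borel) (\<lambda>v. (x, v)))"

definition plans ::
    "'n::finite torus measure \<Rightarrow> real^'n \<Rightarrow> ('n torus \<Rightarrow> (real^'n) measure) set" where
  "plans \<theta> Q = {\<pi>. \<pi> \<in> borel \<rightarrow>\<^sub>M prob_algebra borel \<and>
     (\<forall>\<phi> :: 'n torus \<Rightarrow> real. continuous_on UNIV \<phi> \<longrightarrow>
        (\<integral>(x, v). \<phi> (x \<oplus>\<^sub>T v) \<partial>plan_measure \<theta> \<pi>) = (\<integral>x. \<phi> x \<partial>\<theta>)) \<and>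
     integrable (plan_measure \<theta> \<pi>) (\<lambda>(x, v). v) \<and>
     (\<integral>(x, v). v \<partial>plan_measure \<theta> \<pi>) = Q}"

text \<open>
  The integral with values in \<open>ereal\<close>: unlike the Bochner integral, which is \<open>0\<close> for
  non-integrable functions, it takes the value \<open>\<infinity>\<close> when the positive part has infinite
  integral. The Lagrangians of interest are bounded below, so \<open>\<infinity> - \<infinity>\<close> never occurs.
\<close>

definition ext_integral :: "'a measure \<Rightarrow> ('a \<Rightarrow> real) \<Rightarrow> ereal" where
  "ext_integral M f =
     enn2ereal (\<integral>\<^sup>+z. ennreal (f z) \<partial>M) - enn2ereal (\<integral>\<^sup>+z. ennreal (- f z) \<partial>M)"

definition action ::
    "('n::finite torus \<Rightarrow> real^'n \<Rightarrow> real) \<Rightarrow> ('n torus \<times> (real^'n)) measure \<Rightarrow> ereal" where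
  "action L \<mu> = ext_integral \<mu> (\<lambda>(x, v). L x v)"

end

theory Submission
  imports Defs
begin

text \<open>
  Write \<open>F \<theta>\<close> for the infimum of the action over the plans for \<open>\<theta>\<close>; the theorem asks for a
  maximizer of \<open>F\<close> at which the infimum is attained. The function \<open>F\<close> is convex, because plans
  can be mixed along with their base measures, so its maximum should be sought among Dirac masses,
  and these make everything explicit.

  A plan for the Dirac mass at \<open>x\<close> may only move \<open>x\<close> to itself, so at \<open>x\<close> it is a probability on
  the integer vectors with mean \<open>Q\<close> (\<open>plans_return\<close>). Let \<open>G x\<close> be the minimum of the integral of
  \<open>L x\<close> over such probabilities. Superlinear growth and finite-dimensional duality give a finitely
  supported minimizer together with an affine function of slope \<open>p\<close> which lies below \<open>L x\<close> on the
  integer vectors and has value \<open>G x\<close> at \<open>Q\<close> (\<open>integer_minimizer\<close>). Integrating the affine function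
  shows that no plan for the Dirac mass has smaller action (\<open>dirac_action_ge\<close>).

  The bound on \<open>D\<^sub>xL\<close> makes \<open>G\<close> Lipschitz (\<open>fiber_minimizer_integral_le\<close>), so it has a maximum
  point \<open>x0\<close>. The Dirac mass at \<open>x0\<close> is the required measure: for any other \<open>\<theta>'\<close>, moving each \<open>x\<close>
  by an integer vector drawn from the minimizer at a nearby point \<open>c x\<close> of a finite net leaves
  \<open>\<theta>'\<close> invariant, has mean displacement \<open>Q\<close> (\<open>integer_kernel_in_plans\<close>), and costs at most
  \<open>G x0\<close> plus an arbitrarily small error. Taking only finitely many values of \<open>c\<close> makes this kernel
  measurable without a measurable selection of minimizers.
\<close>

section \<open>Minimizing over probabilities on the integer vectors\<close>

definition integer_vectors :: "(real^'n) set" where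
  "integer_vectors = {v. \<forall>i. v $ i \<in> \<int>}"

lemma continuous_on_Min_image:
  fixes g :: "'b \<Rightarrow> 'a::topological_space \<Rightarrow> real"
  assumes "finite S" "S \<noteq> {}" "\<And>w. w \<in> S \<Longrightarrow> continuous_on A (g w)"
  shows "continuous_on A (\<lambda>p. Min ((\<lambda>w. g w p) ` S))"
  using assms
proof (induction rule: finite_ne_induct)
  case (insert x F)
  have "(\<lambda>p. Min ((\<lambda>w. g w p) ` insert x F)) = (\<lambda>p. min (g x p) (Min ((\<lambda>w. g w p) ` F)))"
    using insert.hyps by (simp add: Min_insert)
  moreover have "continuous_on A (\<lambda>p. min (g x p) (Min ((\<lambda>w. g w p) ` F)))"
    using insert by (intro continuous_on_min) auto
  ultimately show ?case by metis
qed simp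

text \<open>
  The concave function \<open>D p = Min (a w - p \<bullet> w)\<close> is the Lagrange dual of minimizing the mean of \<open>a\<close>
  over probabilities on \<open>S\<close> with mean \<open>0\<close>. The hypothesis says that the closed unit ball lies in the
  convex hull of \<open>S\<close>; it makes \<open>D\<close> tend to \<open>-\<infinity>\<close>, so a maximizer \<open>p\<close> exists. There \<open>0\<close> is in the convex hull
  of the active points, since a hyperplane separating them from \<open>0\<close> would give a direction in which
  all the active terms increase. The middle conclusion only records that \<open>d \<ge> D 0\<close>, from which
  \<open>integer_minimizer\<close> gets a bound on \<open>p\<close> that does not depend on \<open>S\<close>.
\<close>

lemma finite_dual_max:
  fixes a :: "'a::euclidean_space \<Rightarrow> real"
  assumes fin: "finite S" and test: "\<And>p. \<exists>w\<in>S. p \<bullet> w \<ge> norm p"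
  shows "\<exists>p d. (\<forall>w\<in>S. d \<le> a w - p \<bullet> w) \<and> (\<exists>w\<in>S. a w \<le> d) \<and>
    0 \<in> convex hull {w \<in> S. a w - p \<bullet> w = d}"
proof -
  have ne: "S \<noteq> {}" using test[of 0] by auto
  define D where "D p = Min ((\<lambda>w. a w - p \<bullet> w) ` S)" for p
  define K where "K = Max (a ` S)"
  have D_le: "D p \<le> a w - p \<bullet> w" if "w \<in> S" for p w
    unfolding D_def using fin that by (intro Min_le) auto
  have D_att: "\<exists>w\<in>S. D p = a w - p \<bullet> w" for p
  proof -
    have "D p \<in> (\<lambda>w. a w - p \<bullet> w) ` S"
      unfolding D_def using fin ne by (intro Min_in) auto
    then show ?thesis by auto
  qed
  have D_K: "D p \<le> K - norm p" for p
  proof -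
    obtain w where "w \<in> S" "p \<bullet> w \<ge> norm p" using test by blast
    moreover have "a w \<le> K" using \<open>w \<in> S\<close> fin by (auto simp: K_def)
    ultimately show ?thesis using D_le[of w p] by simp
  qed
  have cont: "continuous_on X D" for X
    unfolding D_def using fin ne by (intro continuous_on_Min_image continuous_intros) auto
  have "K - D 0 \<ge> 0" using D_K[of 0] by simp
  then have "cball 0 (K - D 0) \<noteq> ({}::'a set)" by simp
  then obtain p where p: "p \<in> cball 0 (K - D 0)" "\<And>q. q \<in> cball 0 (K - D 0) \<Longrightarrow> D q \<le> D p"
    using continuous_attains_sup[OF compact_cball _ cont] by metis
  have D0: "D 0 \<le> D p" using p(2)[of 0] \<open>K - D 0 \<ge> 0\<close> by simp
  have max: "D q \<le> D p" for q
  proof (cases "q \<in> cball 0 (K - D 0)")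
    case False
    then have "D q \<le> D 0" using D_K[of q] by simp
    then show ?thesis using D0 by simp
  qed (use p in auto)
  let ?A = "{w \<in> S. a w - p \<bullet> w = D p}"
  have "0 \<in> convex hull ?A"
  proof (rule ccontr)
    assume notin: "0 \<notin> convex hull ?A"
    have "closed (convex hull ?A)"
      using fin by (intro compact_imp_closed finite_imp_compact_convex_hull) auto
    from separating_hyperplane_closed_point[OF convex_convex_hull this notin]
    obtain h b where hb: "h \<bullet> 0 < b" "\<forall>x\<in>convex hull ?A. h \<bullet> x > b" by blast
    have hA: "h \<bullet> w > 0" if "w \<in> ?A" for w
    proof -
      have "h \<bullet> w > b" using hb(2) hull_inc[OF that, of convex] by blast
      then show ?thesis using hb(1) by simp
    qed
    \<comment> \<open>Along \<open>p - t h\<close> active terms increase, and inactive ones stay above \<open>D p\<close> for small \<open>t\<close>.\<close>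
    have "\<forall>\<^sub>F t in at_right 0. D p < a w - (p - t *\<^sub>R h) \<bullet> w" if "w \<in> S" for w
    proof (cases "w \<in> ?A")
      case True
      then have "D p < a w - (p - t *\<^sub>R h) \<bullet> w" if "t > 0" for t
        using True mult_pos_pos[OF that hA[OF True]] by (simp add: inner_diff_left)
      then show ?thesis
        by (intro eventually_mono[OF eventually_at_right_less[of "0::real"]]) auto
    next
      case False
      have "((\<lambda>t. a w - (p - t *\<^sub>R h) \<bullet> w) \<longlongrightarrow> a w - (p - 0 *\<^sub>R h) \<bullet> w) (at_right 0)"
        by (intro tendsto_intros)
      moreover have "D p < a w - (p - 0 *\<^sub>R h) \<bullet> w"
        using False D_le[OF that, of p] that by auto
      ultimately show ?thesis by (rule order_tendstoD)
    qed
    then have "\<forall>\<^sub>F t in at_right 0. \<forall>w\<in>S. D p < a w - (p - t *\<^sub>R h) \<bullet> w"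
      using fin by (simp add: eventually_ball_finite)
    then have "\<exists>t. \<forall>w\<in>S. D p < a w - (p - t *\<^sub>R h) \<bullet> w"
      using eventually_happens trivial_limit_at_right_real by blast
    then obtain t where "\<forall>w\<in>S. D p < a w - (p - t *\<^sub>R h) \<bullet> w" by blast
    then have "D p < D (p - t *\<^sub>R h)" using D_att[of "p - t *\<^sub>R h"] by force
    then show False using max[of "p - t *\<^sub>R h"] by simp
  qed
  moreover have "\<exists>w\<in>S. a w \<le> D p" using D_att[of 0] D0 by auto
  ultimately show ?thesis using D_le by blast
qed

lemma finite_integer_vectors_cball: "finite (integer_vectors \<inter> cball (0::real^'n) r)"
proof (rule finite_subset)
  show "integer_vectors \<inter> cball (0::real^'n) r \<subseteq>
    (\<lambda>k. \<chi> i. of_int (k i)) ` (PiE UNIV (\<lambda>_. {- \<lceil>r\<rceil> .. \<lceil>r\<rceil>}))"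
  proof
    fix v :: "real^'n" assume v: "v \<in> integer_vectors \<inter> cball 0 r"
    have "\<bar>v $ i\<bar> \<le> r" for i using v component_le_norm_cart[of v i] by simp
    then have "\<lfloor>v $ i\<rfloor> \<in> {- \<lceil>r\<rceil> .. \<lceil>r\<rceil>}" for i
    proof -
      have "- real_of_int \<lceil>r\<rceil> \<le> v $ i" "v $ i \<le> real_of_int \<lceil>r\<rceil>"
        using \<open>\<And>i. \<bar>v $ i\<bar> \<le> r\<close>[of i] le_of_int_ceiling[of r] by linarith+
      then have "- \<lceil>r\<rceil> \<le> \<lfloor>v $ i\<rfloor>" "\<lfloor>v $ i\<rfloor> \<le> \<lceil>r\<rceil>"
        by (simp_all add: le_floor_iff floor_le_iff)
      then show ?thesis by simp
    qed
    moreover have "v = (\<chi> i. of_int \<lfloor>v $ i\<rfloor>)"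
      using v by (auto simp: integer_vectors_def vec_eq_iff)
    ultimately show "v \<in> (\<lambda>k. \<chi> i. of_int (k i)) ` (PiE UNIV (\<lambda>_. {- \<lceil>r\<rceil> .. \<lceil>r\<rceil>}))"
      by (intro image_eqI[where x = "\<lambda>i. \<lfloor>v $ i\<rfloor>"]) auto
  qed
qed (auto intro!: finite_imageI finite_PiE)

text \<open>
  Rounding \<open>Q\<close> past the next integer, coordinatewise in the direction of the sign of \<open>p\<close>.
\<close>

lemma integer_test_point:
  fixes p Q :: "real^'n"
  shows "\<exists>v\<in>integer_vectors \<inter> cball 0 (\<Sum>i\<in>UNIV. \<bar>Q $ i\<bar> + 2). p \<bullet> (v - Q) \<ge> norm p"
proof -
  define v :: "real^'n" where
    "v = (\<chi> i. if p $ i \<ge> 0 then of_int (\<lceil>Q $ i\<rceil> + 1) else of_int (\<lfloor>Q $ i\<rfloor> - 1))"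
  have "v \<in> integer_vectors" by (auto simp: integer_vectors_def v_def)
  moreover have "norm v \<le> (\<Sum>i\<in>UNIV. \<bar>Q $ i\<bar> + 2)"
  proof -
    have "\<bar>v $ i\<bar> \<le> \<bar>Q $ i\<bar> + 2" for i
    proof -
      have "v $ i = of_int \<lceil>Q $ i\<rceil> + 1 \<or> v $ i = of_int \<lfloor>Q $ i\<rfloor> - 1"
        by (simp add: v_def)
      then show ?thesis
        using le_of_int_ceiling[of "Q $ i"] of_int_ceiling_diff_one_le[of "Q $ i"]
          of_int_floor_le[of "Q $ i"] floor_correct[of "Q $ i"]
        by (elim disjE) linarith+
    qed
    then have "(\<Sum>i\<in>UNIV. \<bar>v $ i\<bar>) \<le> (\<Sum>i\<in>UNIV. \<bar>Q $ i\<bar> + 2)"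
      by (intro sum_mono)
    then show ?thesis using norm_le_l1_cart[of v] by linarith
  qed
  moreover have "norm p \<le> p \<bullet> (v - Q)"
  proof -
    have "\<bar>p $ i\<bar> \<le> p $ i * (v - Q) $ i" for i
    proof (cases "p $ i \<ge> 0")
      case True
      then have "(v - Q) $ i = of_int \<lceil>Q $ i\<rceil> - Q $ i + 1" by (simp add: v_def)
      then have "1 \<le> (v - Q) $ i" using le_of_int_ceiling[of "Q $ i"] by linarith
      then show ?thesis using True mult_left_mono[of 1 "(v - Q) $ i" "p $ i"] by simp
    next
      case False
      then have "(v - Q) $ i = of_int \<lfloor>Q $ i\<rfloor> - Q $ i - 1" by (simp add: v_def)
      then have "(v - Q) $ i \<le> -1" using of_int_floor_le[of "Q $ i"] by linarith
      then show ?thesis using False mult_left_mono_neg[of "(v - Q) $ i" "-1" "p $ i"] by simp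
    qed
    then have "(\<Sum>i\<in>UNIV. \<bar>p $ i\<bar>) \<le> p \<bullet> (v - Q)"
      unfolding inner_vec_def by (simp add: sum_mono)
    then show ?thesis using norm_le_l1_cart[of p] by linarith
  qed
  ultimately show ?thesis by auto
qed

lemma superlinear_bound:
  fixes f :: "'a::real_normed_vector \<Rightarrow> real"
  assumes "filterlim (\<lambda>v. f v / norm v) at_top at_infinity"
  shows "\<exists>r. \<forall>v. norm v > r \<longrightarrow> f v \<ge> B * norm v"
proof -
  have "\<forall>\<^sub>F v in at_infinity. B \<le> f v / norm v"
    using assms by (simp add: filterlim_at_top)
  then obtain r where r: "\<And>v. norm v \<ge> r \<Longrightarrow> B \<le> f v / norm v"
    by (auto simp: eventually_at_infinity)
  have "f v \<ge> B * norm v" if "norm v > max r 0" for v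
    using r[of v] that by (auto simp: le_divide_eq)
  then show ?thesis by blast
qed

text \<open>
  Duality for the infinite set of integer vectors, reduced to \<open>finite_dual_max\<close> on those in a ball.
  The values of \<open>f\<close> at the test points and the lower bound of \<open>f\<close> bound the optimal slope by a number \<open>B\<close>
  that is independent of the radius \<open>R\<close>; hence \<open>R\<close> can be chosen afterwards so large that, outside
  the ball, the superlinear \<open>f\<close> exceeds every affine function that can arise.
\<close>

lemma integer_minimizer:
  fixes f :: "real^'n \<Rightarrow> real"
  assumes super: "filterlim (\<lambda>v. f v / norm v) at_top at_infinity"
  shows "\<exists>p d A u. finite A \<and> A \<subseteq> integer_vectors \<and> (\<forall>v\<in>A. 0 \<le> u v) \<and> sum u A = 1 \<and>
    (\<Sum>v\<in>A. u v *\<^sub>R v) = Q \<and> (\<Sum>v\<in>A. u v * f v) = d \<and>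
    (\<forall>v\<in>integer_vectors. d + p \<bullet> (v - Q) \<le> f v)"
proof -
  define R0 where "R0 = (\<Sum>i\<in>UNIV. \<bar>Q $ i\<bar> + 2)"
  define T where "T = integer_vectors \<inter> cball (0::real^'n) R0"
  have T: "finite T" "\<And>p. \<exists>v\<in>T. p \<bullet> (v - Q) \<ge> norm p"
    using finite_integer_vectors_cball integer_test_point by (auto simp: T_def R0_def)
  define K where "K = Max (f ` T)"
  have K: "f v \<le> K" if "v \<in> T" for v using that T(1) by (auto simp: K_def)
  obtain m where m: "\<And>v. v \<in> integer_vectors \<Longrightarrow> m \<le> f v"
  proof -
    obtain r where r: "\<And>v. norm v > r \<Longrightarrow> f v \<ge> 0 * norm v"
      using superlinear_bound[OF super] by blast
    have "bdd_below (f ` (integer_vectors \<inter> cball 0 r))"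
      using finite_integer_vectors_cball by (intro bdd_below_finite) auto
    then obtain b where b: "\<And>v. v \<in> integer_vectors \<inter> cball 0 r \<Longrightarrow> b \<le> f v"
      unfolding bdd_below_def by blast
    have "min b 0 \<le> f v" if "v \<in> integer_vectors" for v
      using r[of v] b[of v] that by (cases "norm v > r") auto
    then show thesis using that by blast
  qed
  define B where "B = K - m"
  have "B \<ge> 0"
  proof -
    obtain v where "v \<in> T" using T(2)[of 0] by blast
    then show ?thesis using K[of v] m[of v] by (simp add: B_def T_def)
  qed
  obtain r where r: "\<And>v. norm v > r \<Longrightarrow> f v \<ge> (B + 1) * norm v"
    using superlinear_bound[OF super] by blast
  define R where "R = max R0 (max r (B * norm Q + K))"
  define S where "S = (\<lambda>v. v - Q) ` (integer_vectors \<inter> cball 0 R)"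
  have finS: "finite S" unfolding S_def using finite_integer_vectors_cball by blast
  have TS: "v - Q \<in> S" if "v \<in> T" for v using that by (auto simp: S_def T_def R_def)
  have "\<exists>w\<in>S. p \<bullet> w \<ge> norm p" for p using T(2)[of p] TS by blast
  from finite_dual_max[OF finS this, of "\<lambda>w. f (w + Q)"]
  obtain p d where le: "\<And>w. w \<in> S \<Longrightarrow> d \<le> f (w + Q) - p \<bullet> w"
    and ge: "\<exists>w\<in>S. f (w + Q) \<le> d"
    and hull: "0 \<in> convex hull {w \<in> S. f (w + Q) - p \<bullet> w = d}" by blast
  have "m \<le> d" using ge m by (force simp: S_def)
  obtain v0 where v0: "v0 \<in> T" "p \<bullet> (v0 - Q) \<ge> norm p" using T(2) by blast
  have dK: "d \<le> K - norm p" using le[OF TS[OF v0(1)]] v0 K[OF v0(1)] by simp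
  then have pB: "norm p \<le> B" using \<open>m \<le> d\<close> by (simp add: B_def)
  have below: "d + p \<bullet> (v - Q) \<le> f v" if "v \<in> integer_vectors" for v
  proof (cases "norm v \<le> R")
    case True
    then show ?thesis using le[of "v - Q"] that by (auto simp: S_def)
  next
    case False
    have "p \<bullet> (v - Q) \<le> norm p * norm (v - Q)" by (rule norm_cauchy_schwarz)
    also have "\<dots> \<le> B * (norm v + norm Q)"
      using pB \<open>B \<ge> 0\<close> norm_triangle_ineq4[of v Q] by (intro mult_mono) auto
    finally have "d + p \<bullet> (v - Q) \<le> K + B * norm v + B * norm Q"
      using dK norm_ge_zero[of p] by (simp only: distrib_left)
    also have "\<dots> \<le> (B + 1) * norm v" using False by (simp add: R_def algebra_simps)
    also have "\<dots> \<le> f v" using r False by (simp add: R_def)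
    finally show ?thesis .
  qed
  let ?A = "{w \<in> S. f (w + Q) - p \<bullet> w = d}"
  have "finite ?A" using finS by simp
  from hull obtain u where u: "\<And>w. w \<in> ?A \<Longrightarrow> 0 \<le> u w" "sum u ?A = 1"
    "(\<Sum>w\<in>?A. u w *\<^sub>R w) = 0"
    unfolding convex_hull_finite[OF \<open>finite ?A\<close>] by blast
  define A where "A = (\<lambda>w. w + Q) ` ?A"
  define u' where "u' v = u (v - Q)" for v
  have sum_A: "sum g A = (\<Sum>w\<in>?A. g (w + Q))" for g :: "real^'n \<Rightarrow> 'b::comm_monoid_add"
    unfolding A_def by (subst sum.reindex) (auto simp: inj_on_def)
  show ?thesis
  proof (intro exI[of _ p] exI[of _ d] exI[of _ A] exI[of _ u'] conjI ballI)
    show "finite A" using \<open>finite ?A\<close> by (simp add: A_def)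
    show "A \<subseteq> integer_vectors" by (auto simp: A_def S_def)
    show "0 \<le> u' v" if "v \<in> A" for v using that u(1) by (auto simp: A_def u'_def)
    show "sum u' A = 1" using u(2) by (simp add: sum_A u'_def)
    show "(\<Sum>v\<in>A. u' v *\<^sub>R v) = Q"
      using u by (simp add: sum_A u'_def scaleR_add_right sum.distrib flip: scaleR_sum_left)
    have "(\<Sum>v\<in>A. u' v * f v) = (\<Sum>w\<in>?A. u w * (d + p \<bullet> w))"
      unfolding sum_A u'_def by (intro sum.cong) auto
    also have "\<dots> = d * sum u ?A + p \<bullet> (\<Sum>w\<in>?A. u w *\<^sub>R w)"
      by (simp add: algebra_simps sum.distrib inner_sum_right sum_distrib_left)
    finally show "(\<Sum>v\<in>A. u' v * f v) = d" using u by simp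
  qed (use below in auto)
qed

section \<open>Representatives of points of the torus\<close>

text \<open>
  The representative in the half-open unit cube. It is discontinuous but Borel, and it reduces
  measurability and boundedness on the torus to continuity of periodic functions.
\<close>

lift_definition torus_rep :: "'n::finite torus \<Rightarrow> real^'n" is "\<lambda>x. \<chi> i. frac (x $ i)"
proof -
  fix x y :: "real^'n" assume rel: "torus_rel x y"
  have "frac (x $ i) = frac (y $ i)" for i
  proof -
    obtain k where "x $ i - y $ i = of_int k"
      using rel by (auto simp: torus_rel_def elim: Ints_cases)
    then have "x $ i = y $ i + of_int k" by simp
    then show ?thesis by (simp add: frac_def)
  qed
  then show "(\<chi> i. frac (x $ i)) = (\<chi> i. frac (y $ i))" by simp
qed

lemma torus_rep_proj: "torus_rep (torus_proj y) = (\<chi> i. frac (y $ i))"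
  by (simp add: torus_proj_def torus_rep.abs_eq)

lemma torus_proj_eq_iff: "torus_proj x = torus_proj y \<longleftrightarrow> x - y \<in> integer_vectors"
  by (simp add: torus_proj_def torus.abs_eq_iff torus_rel_def integer_vectors_def)

lemma torus_proj_surj: "\<exists>y. x = torus_proj y"
  by (induction x rule: torus.abs_induct) (auto simp: torus_proj_def)

lemma torus_proj_rep [simp]: "torus_proj (torus_rep x) = x"
proof -
  obtain y where y: "x = torus_proj y" using torus_proj_surj by blast
  have "frac (y $ i) - y $ i \<in> \<int>" for i
    by (simp add: frac_def)
  then show ?thesis
    by (simp add: y torus_rep_proj torus_proj_eq_iff integer_vectors_def)
qed

lemma torus_rep_bounds: "torus_rep x \<in> cbox 0 1"
proof -
  obtain y where y: "x = torus_proj y" using torus_proj_surj by blast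
  show ?thesis
    by (simp add: y torus_rep_proj mem_box_cart less_imp_le[OF frac_lt_1])
qed

lemma translate_proj: "torus_proj y \<oplus>\<^sub>T v = torus_proj (y + v)"
  by (simp add: torus_proj_def torus_translate.abs_eq)

lemma translate_eq: "x \<oplus>\<^sub>T v = torus_proj (torus_rep x + v)"
  using translate_proj[of "torus_rep x" v] by simp

lemma translate_eq_iff: "x \<oplus>\<^sub>T v = x \<longleftrightarrow> v \<in> integer_vectors"
  using torus_proj_eq_iff[of "torus_rep x + v" "torus_rep x"] by (simp add: translate_eq)

lemma continuous_on_torus_iff:
  fixes \<phi> :: "'n::finite torus \<Rightarrow> 'b::topological_space"
  shows "continuous_on UNIV \<phi> \<longleftrightarrow> continuous_on UNIV (\<lambda>y. \<phi> (torus_proj y))"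
  by (simp add: continuous_on_open_vimage open_torus_def vimage_def)

lemma frac_greater_iff:
  fixes t :: real
  assumes "a \<ge> 0"
  shows "a < frac t \<longleftrightarrow> (\<exists>k::int. of_int k + a < t \<and> t < of_int k + 1)"
proof
  assume "a < frac t"
  then show "\<exists>k::int. of_int k + a < t \<and> t < of_int k + 1"
    by (intro exI[of _ "\<lfloor>t\<rfloor>"]) (auto simp: frac_def)
next
  assume "\<exists>k::int. of_int k + a < t \<and> t < of_int k + 1"
  then obtain k :: int where k: "of_int k + a < t" "t < of_int k + 1" by blast
  then have "\<lfloor>t\<rfloor> = k" using assms by (intro floor_unique) auto
  then show "a < frac t" using k by (simp add: frac_def)
qed

text \<open>
  For \<open>a \<ge> 0\<close> the condition \<open>a < frac t\<close> defines a union of open intervals, so the superlevel sets of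
  the coordinates are open in the quotient topology.
\<close>

lemma torus_rep_measurable [measurable]:
  "(torus_rep :: 'n::finite torus \<Rightarrow> real^'n) \<in> borel_measurable borel"
proof -
  have comp: "(\<lambda>x. torus_rep x $ i) \<in> borel_measurable borel" for i :: 'n
    unfolding borel_measurable_iff_greater
  proof
    fix a :: real
    show "{w \<in> space borel. a < torus_rep w $ i} \<in> sets borel"
    proof (cases "a \<ge> 0")
      case True
      have "torus_proj -` {w :: 'n torus. a < torus_rep w $ i} =
        (\<Union>k::int. {y. of_int k + a < y $ i \<and> y $ i < of_int k + 1})"
        using frac_greater_iff[OF True] by (auto simp: torus_rep_proj)
      moreover have "open {y :: real^'n. of_int k + a < y $ i \<and> y $ i < of_int k + 1}" for k :: int
        by (intro open_Collect_conj open_Collect_less continuous_intros)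
      ultimately have "open {w :: 'n torus. a < torus_rep w $ i}"
        by (simp add: open_torus_def open_UN)
      then show ?thesis by simp
    next
      case False
      have "0 \<le> torus_rep w $ i" for w :: "'n torus"
        using torus_rep_bounds[of w] by (simp add: mem_box_cart)
      then have "{w \<in> space borel. a < torus_rep w $ i} = UNIV"
        using False by (auto simp: not_le intro: less_le_trans)
      then show ?thesis by simp
    qed
  qed
  show ?thesis
  proof (rule borel_measurable_euclidean_space[THEN iffD2], rule ballI)
    fix b :: "real^'n" assume "b \<in> Basis"
    then obtain i where "b = axis i 1" by (auto simp: Basis_vec_def)
    then show "(\<lambda>x. torus_rep x \<bullet> b) \<in> borel_measurable (borel :: 'n torus measure)"
      using comp[of i] by (simp add: inner_axis)
  qed
qed

lemma borel_measurable_lift: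
  fixes F :: "'n::finite torus \<Rightarrow> real^'n \<Rightarrow> real"
  assumes "continuous_on UNIV (\<lambda>(y, v). F (torus_proj y) v)"
  shows "(\<lambda>(x, v). F x v) \<in> borel_measurable (borel \<Otimes>\<^sub>M borel)"
proof -
  have "continuous_on UNIV (\<lambda>z. F (torus_proj (fst z)) (snd z))"
    using assms by (simp only: split_beta')
  from borel_measurable_continuous_Pair[OF measurable_compose[OF measurable_fst torus_rep_measurable]
      measurable_snd this]
  show ?thesis by (simp only: torus_proj_rep split_beta')
qed

lemma bounded_lift:
  fixes F :: "'n::finite torus \<Rightarrow> real^'n \<Rightarrow> real"
  assumes "continuous_on UNIV (\<lambda>(y, v). F (torus_proj y) v)"
  shows "\<exists>B. \<forall>x v. norm v \<le> R \<longrightarrow> \<bar>F x v\<bar> \<le> B"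
proof -
  have c: "compact (cbox (0::real^'n) 1 \<times> cball (0::real^'n) R)"
    by (rule compact_Times[OF compact_cbox compact_cball])
  define g where "g = (\<lambda>z. F (torus_proj (fst z)) (snd z))"
  have "continuous_on (cbox (0::real^'n) 1 \<times> cball (0::real^'n) R) g"
    using assms continuous_on_subset unfolding g_def case_prod_beta by blast
  with c have "compact (g ` (cbox (0::real^'n) 1 \<times> cball (0::real^'n) R))"
    using compact_continuous_image by blast
  then have "bounded (g ` (cbox (0::real^'n) 1 \<times> cball (0::real^'n) R))"
    by (rule compact_imp_bounded)
  then obtain B where B: "\<forall>z\<in>g ` (cbox (0::real^'n) 1 \<times> cball (0::real^'n) R). norm z \<le> B"
    unfolding bounded_iff by (elim exE)
  have "\<bar>F (torus_proj x) v\<bar> \<le> B" if "x \<in> cbox 0 1" "norm v \<le> R" for x v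
  proof -
    have "g (x, v) \<in> g ` (cbox (0::real^'n) 1 \<times> cball (0::real^'n) R)"
      using that by (intro imageI) simp
    with B have "norm (g (x,v)) \<le> B" by blast
    then show ?thesis by (simp add: g_def)
  qed
  from this[OF torus_rep_bounds] have "\<bar>F x v\<bar> \<le> B" if "norm v \<le> R" for x v
    using that by simp
  then show ?thesis by blast
qed

section \<open>Plans that move by integer vectors\<close>

lemma plan_kernel_measurable:
  assumes [measurable]: "\<pi> \<in> borel \<rightarrow>\<^sub>M prob_algebra borel"
  shows "(\<lambda>x::'n::finite torus. distr (\<pi> x :: (real^'n) measure) (borel \<Otimes>\<^sub>M borel) (\<lambda>v. (x, v)))
    \<in> borel \<rightarrow>\<^sub>M prob_algebra (borel \<Otimes>\<^sub>M borel)"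
  by measurable

lemma kernel_props:
  assumes "\<pi> \<in> borel \<rightarrow>\<^sub>M prob_algebra borel"
  shows "prob_space (\<pi> x)" "sets (\<pi> x) = sets borel"
  using measurable_space[OF assms, of x] by (auto simp: space_prob_algebra)

text \<open>
  Fubini for plans with bounded displacement. The integrand is cut off outside the ball of radius \<open>R\<close>,
  which changes it only on a null set and makes it bounded everywhere.
\<close>

lemma plan_integral:
  fixes \<theta> :: "'n::finite torus measure" and \<pi> :: "'n torus \<Rightarrow> (real^'n) measure"
    and F :: "'n torus \<Rightarrow> real^'n \<Rightarrow> real"
  assumes \<theta>: "\<theta> \<in> space (prob_algebra borel)" and \<pi>: "\<pi> \<in> borel \<rightarrow>\<^sub>M prob_algebra borel"
    and supp: "\<And>x. AE v in \<pi> x. norm v \<le> R"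
    and cont: "continuous_on UNIV (\<lambda>(y, v). F (torus_proj y) v)"
  shows "integrable (plan_measure \<theta> \<pi>) (\<lambda>(x, v). F x v)"
    and "(\<integral>(x, v). F x v \<partial>plan_measure \<theta> \<pi>) = (\<integral>x. (\<integral>v. F x v \<partial>\<pi> x) \<partial>\<theta>)"
    and "integrable \<theta> (\<lambda>x. \<integral>v. F x v \<partial>\<pi> x)"
proof -
  have sets_\<theta> [measurable_cong]: "sets \<theta> = sets borel" and "prob_space \<theta>"
    using \<theta> by (auto simp: space_prob_algebra)
  interpret \<theta>: prob_space \<theta> by fact
  define P where "P x = distr (\<pi> x) (borel \<Otimes>\<^sub>M borel) (\<lambda>v. (x, v))" for x
  have P: "P \<in> \<theta> \<rightarrow>\<^sub>M subprob_algebra (borel \<Otimes>\<^sub>M borel)"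
    using measurable_prob_algebraD[OF plan_kernel_measurable[OF \<pi>]]
    unfolding P_def[abs_def] measurable_cong_sets[OF sets_\<theta> refl] .
  have plan: "plan_measure \<theta> \<pi> = \<theta> \<bind> P" by (simp add: plan_measure_def P_def[abs_def])
  obtain B where B: "\<And>x v. norm v \<le> R \<Longrightarrow> \<bar>F x v\<bar> \<le> B" using bounded_lift[OF cont] by blast
  have F [measurable]: "(\<lambda>(x, v). F x v) \<in> borel_measurable (borel \<Otimes>\<^sub>M borel)"
    by (rule borel_measurable_lift[OF cont])
  define G where "G z = (if norm (snd z) \<le> R then F (fst z) (snd z) else 0)" for z :: "'n torus \<times> (real^'n)"
  have G [measurable]: "G \<in> borel_measurable (borel \<Otimes>\<^sub>M borel)"
    unfolding G_def[abs_def] using F by (simp add: case_prod_beta)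
  have G_bound: "\<bar>G z\<bar> \<le> \<bar>B\<bar>" for z
    using B[of "snd z" "fst z"] by (auto simp: G_def)
  have P_bound: "AE x in \<theta>. emeasure (P x) (space (P x)) \<le> ennreal 1"
    using subprob_space.subprob_emeasure_le_1[OF subprob_space_kernel[OF P]] by (intro AE_I2) simp
  note bind = integrable_bind[OF G G_bound P \<theta>.finite_measure_axioms P_bound]
    integral_bind[OF G G_bound P \<theta>.finite_measure_axioms P_bound]
  have [measurable_cong]: "sets (\<theta> \<bind> P) = sets (borel \<Otimes>\<^sub>M borel)"
    using sets_bind[of \<theta> P] subprob_measurableD(2)[OF P] \<theta>.not_empty by simp
  have "AE x in \<theta>. AE z in P x. norm (snd z) \<le> R"
  proof (rule AE_I2)
    fix x
    note [measurable_cong] = kernel_props(2)[OF \<pi>, of x]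
    show "AE z in P x. norm (snd z) \<le> R"
      unfolding P_def by (subst AE_distr_iff) (use supp[of x] in auto)
  qed
  then have AE: "AE z in \<theta> \<bind> P. norm (snd z) \<le> R"
    by (subst AE_bind[OF P]) auto
  have eq: "AE z in \<theta> \<bind> P. G z = (case z of (x, v) \<Rightarrow> F x v)"
    using AE by eventually_elim (auto simp: G_def)
  show "integrable (plan_measure \<theta> \<pi>) (\<lambda>(x, v). F x v)"
    unfolding plan using bind(1) eq
    by (subst (asm) integrable_cong_AE[OF _ _ eq]) (auto simp: split_beta')
  have inner: "(\<integral>z. G z \<partial>P x) = (\<integral>v. F x v \<partial>\<pi> x)" for x
  proof -
    note [measurable_cong] = kernel_props(2)[OF \<pi>, of x]
    have "(\<integral>z. G z \<partial>P x) = (\<integral>v. G (x, v) \<partial>\<pi> x)"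
      unfolding P_def by (rule integral_distr) auto
    also have "\<dots> = (\<integral>v. F x v \<partial>\<pi> x)"
      using supp[of x] measurable_Pair2[OF F, of x] measurable_Pair2[OF G, of x]
      by (intro integral_cong_AE) (auto simp: G_def elim!: eventually_mono)
    finally show ?thesis .
  qed
  have "(\<integral>(x, v). F x v \<partial>plan_measure \<theta> \<pi>) = (\<integral>z. G z \<partial>(\<theta> \<bind> P))"
    unfolding plan using eq by (intro integral_cong_AE) auto
  also have "\<dots> = (\<integral>x. (\<integral>z. G z \<partial>P x) \<partial>\<theta>)" by (rule bind(2))
  finally show "(\<integral>(x, v). F x v \<partial>plan_measure \<theta> \<pi>) = (\<integral>x. (\<integral>v. F x v \<partial>\<pi> x) \<partial>\<theta>)"
    by (simp only: inner)
  have "\<bar>\<integral>z. G z \<partial>P x\<bar> \<le> \<bar>B\<bar>" for x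
  proof -
    have PP: "P x \<in> space (prob_algebra (borel \<Otimes>\<^sub>M borel))"
      using measurable_space[OF plan_kernel_measurable[OF \<pi>], of x] by (simp add: P_def)
    then have [measurable_cong]: "sets (P x) = sets (borel \<Otimes>\<^sub>M borel)" and "prob_space (P x)"
      by (auto simp: space_prob_algebra)
    interpret Px: prob_space "P x" by fact
    have "integrable (P x) G"
      using G_bound by (intro Px.integrable_const_bound[of _ "\<bar>B\<bar>"]) auto
    note int = this
    have "- \<bar>B\<bar> \<le> G z" "G z \<le> \<bar>B\<bar>" for z
      using G_bound[of z] by linarith+
    then have "- \<bar>B\<bar> \<le> (\<integral>z. G z \<partial>P x)" "(\<integral>z. G z \<partial>P x) \<le> \<bar>B\<bar>"
      using Px.integral_ge_const[OF int AE_I2] Px.integral_le_const[OF int AE_I2] by blast+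
    then show ?thesis by (simp add: abs_le_iff)
  qed
  moreover have "(\<lambda>x. \<integral>z. G z \<partial>P x) \<in> borel_measurable \<theta>"
    by (rule measurable_compose[OF P integral_measurable_subprob_algebra[OF G]])
  ultimately have "integrable \<theta> (\<lambda>x. \<integral>z. G z \<partial>P x)"
    by (intro \<theta>.integrable_const_bound[of _ "\<bar>B\<bar>"]) auto
  then show "integrable \<theta> (\<lambda>x. \<integral>v. F x v \<partial>\<pi> x)" by (simp only: inner)
qed

lemma sets_plan_measure:
  assumes \<theta>: "\<theta> \<in> space (prob_algebra borel)" and \<pi>: "\<pi> \<in> borel \<rightarrow>\<^sub>M prob_algebra borel"
  shows "sets (plan_measure \<theta> \<pi>) = sets (borel \<Otimes>\<^sub>M borel)"
  unfolding plan_measure_def by (rule sets_bind'[OF \<theta> plan_kernel_measurable[OF \<pi>]])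

lemma integrable_AE_cball:
  fixes \<sigma> :: "'a::euclidean_space measure"
  assumes "prob_space \<sigma>" "sets \<sigma> = sets borel" "AE v in \<sigma>. norm v \<le> R"
    and cont: "continuous_on UNIV (f :: 'a \<Rightarrow> 'b::{banach, second_countable_topology})"
  shows "integrable \<sigma> f"
proof -
  interpret prob_space \<sigma> by fact
  have [measurable]: "f \<in> borel_measurable \<sigma>"
    using borel_measurable_continuous_onI[OF cont] assms(2) by (simp cong: measurable_cong_sets)
  have "bounded (f ` cball 0 R)"
    by (rule compact_imp_bounded[OF compact_continuous_image[OF continuous_on_subset[OF cont subset_UNIV] compact_cball]])
  then obtain B where B: "\<forall>z\<in>f ` cball 0 R. norm z \<le> B"
    unfolding bounded_iff by (elim exE)
  have "AE v in \<sigma>. norm (f v) \<le> B"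
    using assms(3) by eventually_elim (use B in auto)
  then show ?thesis by (rule integrable_const_bound) measurable
qed

text \<open>
  Integer displacements fix every point of the torus, so such a kernel preserves every base measure.
\<close>

lemma integer_kernel_in_plans:
  fixes \<theta> :: "'n::finite torus measure" and \<pi> :: "'n torus \<Rightarrow> (real^'n) measure"
  assumes \<theta>: "\<theta> \<in> space (prob_algebra borel)" and \<pi>: "\<pi> \<in> borel \<rightarrow>\<^sub>M prob_algebra borel"
    and lat: "\<And>x. AE v in \<pi> x. v \<in> integer_vectors" and bd: "\<And>x. AE v in \<pi> x. norm v \<le> R"
    and mean: "\<And>x. (\<integral>v. v \<partial>\<pi> x) = Q"
  shows "\<pi> \<in> plans \<theta> Q"
proof -
  note [measurable_cong] = sets_plan_measure[OF \<theta> \<pi>]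
  interpret \<theta>: prob_space \<theta> using \<theta> by (simp add: space_prob_algebra)
  have bal: "(\<integral>(x, v). \<phi> (x \<oplus>\<^sub>T v) \<partial>plan_measure \<theta> \<pi>) = (\<integral>x. \<phi> x \<partial>\<theta>)"
    if "continuous_on UNIV \<phi>" for \<phi> :: "'n torus \<Rightarrow> real"
  proof -
    have c: "continuous_on UNIV (\<lambda>y. \<phi> (torus_proj y))"
      using that by (simp add: continuous_on_torus_iff)
    have "continuous_on UNIV (\<lambda>(y, v). \<phi> (torus_proj y \<oplus>\<^sub>T v))"
      unfolding translate_proj split_beta'
      by (rule continuous_on_compose2[OF c]) (auto intro!: continuous_intros)
    from plan_integral(2)[OF \<theta> \<pi> bd this]
    have "(\<integral>(x, v). \<phi> (x \<oplus>\<^sub>T v) \<partial>plan_measure \<theta> \<pi>) = (\<integral>x. (\<integral>v. \<phi> (x \<oplus>\<^sub>T v) \<partial>\<pi> x) \<partial>\<theta>)" .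
    moreover have "(\<integral>v. \<phi> (x \<oplus>\<^sub>T v) \<partial>\<pi> x) = \<phi> x" for x
    proof -
      interpret \<pi>: prob_space "\<pi> x" by (rule kernel_props(1)[OF \<pi>])
      note [measurable_cong] = kernel_props(2)[OF \<pi>, of x]
      have "continuous_on UNIV (\<lambda>v. \<phi> (x \<oplus>\<^sub>T v))"
        unfolding translate_eq
        by (rule continuous_on_compose2[OF c]) (auto intro!: continuous_intros)
      from borel_measurable_continuous_onI[OF this]
      have [measurable]: "(\<lambda>v. \<phi> (x \<oplus>\<^sub>T v)) \<in> borel_measurable (\<pi> x)" by measurable
      have "AE v in \<pi> x. \<phi> (x \<oplus>\<^sub>T v) = \<phi> x"
        using lat[of x] by eventually_elim (simp add: translate_eq_iff[THEN iffD2])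
      then have "(\<integral>v. \<phi> (x \<oplus>\<^sub>T v) \<partial>\<pi> x) = (\<integral>v. \<phi> x \<partial>\<pi> x)"
        by (intro integral_cong_AE) auto
      then show ?thesis by (simp add: \<pi>.prob_space)
    qed
    ultimately show ?thesis by (simp only:)
  qed
  have int: "integrable (plan_measure \<theta> \<pi>) (\<lambda>(x, v). v)"
  proof (rule Bochner_Integration.integrable_bound)
    show "integrable (plan_measure \<theta> \<pi>) (\<lambda>(x, v). norm v)"
      by (rule plan_integral(1)[OF \<theta> \<pi> bd])
        (auto simp: split_beta' intro!: continuous_intros)
  qed (auto simp: split_beta')
  have "(\<integral>(x, v). v \<partial>plan_measure \<theta> \<pi>) = Q"
  proof (rule euclidean_eqI)
    fix b :: "real^'n"
    have "(\<integral>(x, v). v \<partial>plan_measure \<theta> \<pi>) \<bullet> b = (\<integral>(x, v). v \<bullet> b \<partial>plan_measure \<theta> \<pi>)"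
      using integral_inner_left[of b, OF int] by (simp add: split_beta')
    also have "\<dots> = (\<integral>x. (\<integral>v. v \<bullet> b \<partial>\<pi> x) \<partial>\<theta>)"
      by (rule plan_integral(2)[OF \<theta> \<pi> bd])
        (auto simp: split_beta' intro!: continuous_intros)
    finally have "(\<integral>(x, v). v \<partial>plan_measure \<theta> \<pi>) \<bullet> b = (\<integral>x. (\<integral>v. v \<bullet> b \<partial>\<pi> x) \<partial>\<theta>)" .
    moreover have "(\<integral>v. v \<bullet> b \<partial>\<pi> x) = Q \<bullet> b" for x
    proof -
      have "integrable (\<pi> x) (\<lambda>v. v)"
        by (rule integrable_AE_cball[OF kernel_props[OF \<pi>] bd]) (rule continuous_on_id)
      then show ?thesis using integral_inner_left[of b "\<pi> x" "\<lambda>v. v"] mean[of x] by simp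
    qed
    ultimately show "(\<integral>(x, v). v \<partial>plan_measure \<theta> \<pi>) \<bullet> b = Q \<bullet> b"
      by (simp add: \<theta>.prob_space)
  qed
  with \<pi> bal int show ?thesis by (simp add: plans_def)
qed

section \<open>The extended integral\<close>

lemma ext_integral_integrable:
  assumes "integrable M f"
  shows "ext_integral M f = ereal (\<integral>x. f x \<partial>M)"
proof -
  have fin: "(\<integral>\<^sup>+x. ennreal (f x) \<partial>M) < \<top>" "(\<integral>\<^sup>+x. ennreal (- f x) \<partial>M) < \<top>"
    using assms by (auto simp: real_integrable_def less_top)
  have "enn2ereal n = ereal (enn2real n)" if "n < \<top>" for n
    by (metis enn2ereal_ennreal[OF enn2real_nonneg] ennreal_enn2real[OF that])
  from this[OF fin(1)] this[OF fin(2)] show ?thesis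
    unfolding ext_integral_def real_lebesgue_integral_def[OF assms] by simp
qed

text \<open>
  The positive parts increase, the negative parts decrease, and subtraction on \<open>ereal\<close> is monotone
  even at infinite values.
\<close>

lemma ext_integral_mono:
  assumes "AE x in M. g x \<le> f x"
  shows "ext_integral M g \<le> ext_integral M f"
proof -
  have "(\<integral>\<^sup>+x. ennreal (g x) \<partial>M) \<le> (\<integral>\<^sup>+x. ennreal (f x) \<partial>M)"
    "(\<integral>\<^sup>+x. ennreal (- f x) \<partial>M) \<le> (\<integral>\<^sup>+x. ennreal (- g x) \<partial>M)"
    using assms by (auto intro!: nn_integral_mono_AE ennreal_leI elim!: eventually_mono)
  then show ?thesis
    unfolding ext_integral_def by (intro ereal_minus_mono) (simp_all add: less_eq_ennreal.rep_eq)
qed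

lemma ext_integral_distr:
  assumes "f \<in> M \<rightarrow>\<^sub>M N" "g \<in> borel_measurable N"
  shows "ext_integral (distr M N f) g = ext_integral M (\<lambda>x. g (f x))"
  using assms by (simp add: ext_integral_def nn_integral_distr)

section \<open>Plans over a Dirac mass\<close>

lemma plan_measure_return:
  assumes "\<pi> \<in> borel \<rightarrow>\<^sub>M prob_algebra borel"
  shows "plan_measure (return borel x) \<pi> = distr (\<pi> x) (borel \<Otimes>\<^sub>M borel) (\<lambda>v. (x, v))"
  unfolding plan_measure_def
  by (rule bind_return[OF measurable_prob_algebraD[OF plan_kernel_measurable[OF assms]]]) simp

lemma cos_2pi_minus_int: "cos (2 * pi * (t - of_int k)) = cos (2 * pi * t)"
  by (simp add: right_diff_distrib cos_diff)

text \<open>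
  The balance condition is tested on one continuous function that is nonnegative and vanishes only at
  \<open>x\<close>, a sum of terms \<open>1 - cos\<close>: its integral over \<open>\<pi> x\<close> is zero, so almost every displacement is an
  integer vector.
\<close>

lemma plans_return:
  fixes x :: "'n::finite torus"
  assumes \<pi>: "\<pi> \<in> plans (return borel x) Q"
  shows "AE v in \<pi> x. v \<in> integer_vectors" "integrable (\<pi> x) (\<lambda>v. v)" "(\<integral>v. v \<partial>\<pi> x) = Q"
proof -
  have \<pi>m: "\<pi> \<in> borel \<rightarrow>\<^sub>M prob_algebra borel" using \<pi> by (simp add: plans_def)
  note [measurable_cong] = kernel_props(2)[OF \<pi>m, of x]
  interpret \<pi>: prob_space "\<pi> x" by (rule kernel_props(1)[OF \<pi>m])
  have pair: "(\<lambda>v. (x, v)) \<in> \<pi> x \<rightarrow>\<^sub>M borel \<Otimes>\<^sub>M borel" by measurable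
  have snd: "(\<lambda>(x, v). v) \<in> borel_measurable (borel \<Otimes>\<^sub>M borel :: ('n torus \<times> (real^'n)) measure)"
    unfolding split_beta' by measurable
  have "integrable (distr (\<pi> x) (borel \<Otimes>\<^sub>M borel) (\<lambda>v. (x, v))) (\<lambda>(x, v). v)"
    and "(\<integral>(x, v). v \<partial>distr (\<pi> x) (borel \<Otimes>\<^sub>M borel) (\<lambda>v. (x, v))) = Q"
    using \<pi> by (auto simp: plans_def plan_measure_return[OF \<pi>m])
  then show "integrable (\<pi> x) (\<lambda>v. v)" "(\<integral>v. v \<partial>\<pi> x) = Q"
    using integrable_distr[OF pair, of "\<lambda>(x, v). v"] integral_distr[OF pair snd] by auto
  define \<phi> where "\<phi> y = (\<Sum>i\<in>UNIV. 1 - cos (2 * pi * (torus_rep y $ i - torus_rep x $ i)))" for y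
  have \<phi>_proj: "\<phi> (torus_proj y) = (\<Sum>i\<in>UNIV. 1 - cos (2 * pi * (y $ i - torus_rep x $ i)))" for y
  proof -
    have "cos (2 * pi * (frac (y $ i) - torus_rep x $ i)) = cos (2 * pi * (y $ i - torus_rep x $ i))" for i
      using cos_2pi_minus_int[of "y $ i - torus_rep x $ i" "\<lfloor>y $ i\<rfloor>"]
      by (simp add: frac_def algebra_simps)
    then show ?thesis by (simp add: \<phi>_def torus_rep_proj)
  qed
  have cont: "continuous_on UNIV (\<lambda>y. \<phi> (torus_proj y))"
    unfolding \<phi>_proj by (intro continuous_intros)
  have \<phi>_tr: "\<phi> (x \<oplus>\<^sub>T v) = (\<Sum>i\<in>UNIV. 1 - cos (2 * pi * v $ i))" for v
    by (simp add: translate_eq \<phi>_proj)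
  have \<phi>_meas: "(\<lambda>(x, v). \<phi> (x \<oplus>\<^sub>T v)) \<in> borel_measurable (borel \<Otimes>\<^sub>M borel)"
  proof (rule borel_measurable_lift)
    show "continuous_on UNIV (\<lambda>(y, v). \<phi> (torus_proj y \<oplus>\<^sub>T v))"
      unfolding translate_proj split_beta'
      by (rule continuous_on_compose2[OF cont]) (auto intro!: continuous_intros)
  qed
  have \<phi>_cont: "continuous_on UNIV \<phi>" using cont by (simp add: continuous_on_torus_iff)
  have "(\<integral>(x, v). \<phi> (x \<oplus>\<^sub>T v) \<partial>plan_measure (return borel x) \<pi>) = (\<integral>y. \<phi> y \<partial>return borel x)"
    using \<pi> \<phi>_cont by (simp add: plans_def)
  also have "\<dots> = \<phi> x"
    by (rule integral_return) (auto intro: borel_measurable_continuous_onI[OF \<phi>_cont])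
  also have "\<phi> x = 0" by (simp add: \<phi>_def)
  finally have "(\<integral>v. \<phi> (x \<oplus>\<^sub>T v) \<partial>\<pi> x) = 0"
    unfolding plan_measure_return[OF \<pi>m] using integral_distr[OF pair \<phi>_meas] by simp
  then have zero: "(\<integral>v. (\<Sum>i\<in>UNIV. 1 - cos (2 * pi * v $ i)) \<partial>\<pi> x) = 0"
    by (simp only: \<phi>_tr)
  have nonneg: "0 \<le> (\<Sum>i\<in>UNIV. 1 - cos (2 * pi * v $ i))" for v :: "real^'n"
    by (intro sum_nonneg) simp
  have "(\<Sum>i\<in>UNIV. 1 - cos (2 * pi * v $ i)) \<le> (\<Sum>i\<in>(UNIV::'n set). 2)" for v :: "real^'n"
  proof (rule sum_mono)
    show "1 - cos (2 * pi * v $ i) \<le> 2" for i using cos_ge_minus_one[of "2 * pi * v $ i"] by linarith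
  qed
  then have "integrable (\<pi> x) (\<lambda>v. \<Sum>i\<in>UNIV. 1 - cos (2 * pi * v $ i))"
    using nonneg
    by (intro \<pi>.integrable_const_bound[of _ "\<Sum>i\<in>(UNIV::'n set). 2"])
      (auto simp del: sum_constant intro!: borel_measurable_continuous_onI continuous_intros
         simp: abs_of_nonneg measurable_cong_sets[OF kernel_props(2)[OF \<pi>m, of x] refl])
  from integral_nonneg_eq_0_iff_AE[OF this] zero nonneg
  have "AE v in \<pi> x. (\<Sum>i\<in>UNIV. 1 - cos (2 * pi * v $ i)) = 0" by auto
  then show "AE v in \<pi> x. v \<in> integer_vectors"
  proof eventually_elim
    case (elim v)
    have "1 - cos (2 * pi * v $ i) = 0" for i
      using elim sum_nonneg_eq_0_iff[of UNIV "\<lambda>i. 1 - cos (2 * pi * v $ i)"] by simp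
    then have "cos (2 * pi * v $ i) = 1" for i by simp
    then have "\<exists>n::int. 2 * pi * v $ i = of_int n * 2 * pi" for i
      by (simp only: cos_one_2pi_int)
    then have "v $ i \<in> \<int>" for i by (auto simp: Ints_def image_iff)
    then show ?case by (simp add: integer_vectors_def)
  qed
qed

text \<open>
  Weak duality: the affine minorant integrates to its value \<open>d\<close> at the mean \<open>Q\<close>.
\<close>

lemma dirac_action_ge:
  fixes x :: "'n::finite torus"
  assumes \<pi>: "\<pi> \<in> plans (return borel x) Q"
    and meas: "(\<lambda>(x, v). L x v) \<in> borel_measurable (borel \<Otimes>\<^sub>M borel)"
    and below: "\<And>v. v \<in> integer_vectors \<Longrightarrow> d + p \<bullet> (v - Q) \<le> L x v"
  shows "ereal d \<le> action L (plan_measure (return borel x) \<pi>)"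
proof -
  have \<pi>m: "\<pi> \<in> borel \<rightarrow>\<^sub>M prob_algebra borel" using \<pi> by (simp add: plans_def)
  note [measurable_cong] = kernel_props(2)[OF \<pi>m, of x]
  interpret \<pi>: prob_space "\<pi> x" by (rule kernel_props(1)[OF \<pi>m])
  note props = plans_return[OF \<pi>]
  have int: "integrable (\<pi> x) (\<lambda>v. d + p \<bullet> (v - Q))"
    using props(2) by simp
  have "(\<integral>v. d + p \<bullet> (v - Q) \<partial>\<pi> x) = d"
    using props(2,3) by (simp add: \<pi>.prob_space inner_diff_right)
  then have "ereal d = ext_integral (\<pi> x) (\<lambda>v. d + p \<bullet> (v - Q))"
    by (simp add: ext_integral_integrable[OF int])
  also have "\<dots> \<le> ext_integral (\<pi> x) (L x)"
    using props(1) below by (intro ext_integral_mono) (auto elim: eventually_mono)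
  also have "\<dots> = action L (plan_measure (return borel x) \<pi>)"
    unfolding action_def plan_measure_return[OF \<pi>m]
    by (subst ext_integral_distr[OF _ meas]) simp_all
  finally show ?thesis .
qed

section \<open>Minimizers in a single fiber\<close>

definition atomic :: "'a::euclidean_space set \<Rightarrow> ('a \<Rightarrow> real) \<Rightarrow> 'a measure" where
  "atomic A u = distr (measure_pmf (embed_pmf (\<lambda>v. if v \<in> A then u v else 0))) borel (\<lambda>v. v)"

lemma atomic:
  assumes A: "finite A" "\<forall>v\<in>A. 0 \<le> u v" "sum u A = 1"
  shows atomic_prob: "atomic A u \<in> space (prob_algebra borel)"
    and AE_atomic: "AE v in atomic A u. v \<in> A"
    and integral_atomic: "f \<in> borel_measurable borel \<Longrightarrow>
      (\<integral>v. f v \<partial>atomic A u) = (\<Sum>v\<in>A. u v *\<^sub>R (f v :: 'b::{banach, second_countable_topology}))"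
proof -
  let ?w = "\<lambda>v. if v \<in> A then u v else 0"
  have "(\<integral>\<^sup>+v. ennreal (?w v) \<partial>count_space UNIV) = (\<Sum>v\<in>A. ennreal (?w v))"
    using A(1) by (intro nn_integral_count_space'[of A]) auto
  also have "\<dots> = ennreal (\<Sum>v\<in>A. u v)"
    using A(2) by (simp add: sum_ennreal)
  finally have total: "(\<integral>\<^sup>+v. ennreal (?w v) \<partial>count_space UNIV) = 1" by (simp add: A(3))
  have nonneg: "0 \<le> ?w v" for v using A(2) by simp
  note pmf = pmf_embed_pmf[OF nonneg total] and set = set_embed_pmf[OF nonneg total]
  show "atomic A u \<in> space (prob_algebra borel)"
    by (auto simp: atomic_def space_prob_algebra intro!: measure_pmf.prob_space_distr)
  have "A \<in> sets borel" using A(1) by (intro borel_closed finite_imp_closed)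
  then show "AE v in atomic A u. v \<in> A"
    unfolding atomic_def
    by (subst AE_distr_iff) (auto simp: AE_measure_pmf_iff set split: if_splits)
  show "(\<integral>v. f v \<partial>atomic A u) = (\<Sum>v\<in>A. u v *\<^sub>R f v)" if "f \<in> borel_measurable borel"
  proof -
    have "(\<integral>v. f v \<partial>measure_pmf (embed_pmf ?w)) = (\<Sum>v\<in>A. pmf (embed_pmf ?w) v *\<^sub>R f v)"
      by (rule integral_measure_pmf[OF A(1)]) (auto simp: set split: if_splits)
    then show ?thesis
      unfolding atomic_def using that by (subst integral_distr) (simp_all add: pmf)
  qed
qed

text \<open>
  \<open>\<sigma>\<close> minimizes the integral of \<open>f\<close> over probabilities on the integer vectors with mean \<open>Q\<close>, and \<open>d\<close>
  is the minimum; optimality is encoded by the affine minorant with value \<open>d\<close> at \<open>Q\<close>.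
\<close>

definition fiber_minimizer ::
    "(real^'n \<Rightarrow> real) \<Rightarrow> real^'n \<Rightarrow> (real^'n) measure \<Rightarrow> real \<Rightarrow> bool" where
  "fiber_minimizer f Q \<sigma> d \<longleftrightarrow>
     \<sigma> \<in> space (prob_algebra borel) \<and> (AE v in \<sigma>. v \<in> integer_vectors) \<and> (\<exists>R. AE v in \<sigma>. norm v \<le> R) \<and>
     (\<integral>v. v \<partial>\<sigma>) = Q \<and> (\<integral>v. f v \<partial>\<sigma>) = d \<and> (\<exists>p. \<forall>v\<in>integer_vectors. d + p \<bullet> (v - Q) \<le> f v)"

lemma fiber_minimizer_exists:
  assumes cont: "continuous_on UNIV f"
    and super: "filterlim (\<lambda>v. f v / norm v) at_top at_infinity"
  shows "\<exists>\<sigma> d. fiber_minimizer f Q \<sigma> d"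
proof -
  obtain p d A u where A: "finite A" "A \<subseteq> integer_vectors" "\<forall>v\<in>A. 0 \<le> u v" "sum u A = 1"
    "(\<Sum>v\<in>A. u v *\<^sub>R v) = Q" "(\<Sum>v\<in>A. u v * f v) = d"
    "\<forall>v\<in>integer_vectors. d + p \<bullet> (v - Q) \<le> f v"
    using integer_minimizer[OF super, of Q] by blast
  note at = AE_atomic[OF A(1,3,4)]
  have "AE v in atomic A u. v \<in> integer_vectors"
    using at by eventually_elim (use A(2) in auto)
  moreover have "AE v in atomic A u. norm v \<le> Max (norm ` A)"
    using at by eventually_elim (use A(1) in auto)
  moreover have "(\<integral>v. v \<partial>atomic A u) = Q"
    using integral_atomic[OF A(1,3,4), of "\<lambda>v. v"] A(5) by simp
  moreover have "(\<integral>v. f v \<partial>atomic A u) = d"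
    using integral_atomic[OF A(1,3,4) borel_measurable_continuous_onI[OF cont]] A(6) by simp
  ultimately have "fiber_minimizer f Q (atomic A u) d"
    unfolding fiber_minimizer_def using A(7) atomic_prob[OF A(1,3,4)] by blast
  then show ?thesis by blast
qed

text \<open>
  The minimizer \<open>\<tau>\<close> for \<open>g\<close> is a competitor for \<open>f\<close>. The first part gives the Lipschitz bound for
  the minimum as a function of the base point, the second the cost of using \<open>\<tau>\<close> at a nearby point.
\<close>

lemma fiber_minimizer_integral_le:
  assumes f: "fiber_minimizer f Q \<sigma> d" and g: "fiber_minimizer g Q \<tau> e"
    and cf: "continuous_on UNIV f" and cg: "continuous_on UNIV g"
    and le: "\<And>v. f v \<le> g v + K"
  shows "d \<le> e + K" "(\<integral>v. f v \<partial>\<tau>) \<le> e + K"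
proof -
  obtain R where \<tau>: "prob_space \<tau>" "sets \<tau> = sets borel" "AE v in \<tau>. v \<in> integer_vectors"
    "AE v in \<tau>. norm v \<le> R" "(\<integral>v. v \<partial>\<tau>) = Q" "(\<integral>v. g v \<partial>\<tau>) = e"
    using g by (auto simp: fiber_minimizer_def space_prob_algebra)
  interpret \<tau>: prob_space \<tau> by fact
  note int = integrable_AE_cball[OF \<tau>(1,2,4)]
  obtain p where p: "\<forall>v\<in>integer_vectors. d + p \<bullet> (v - Q) \<le> f v"
    using f by (auto simp: fiber_minimizer_def)
  have "integrable \<tau> (\<lambda>v. v)" by (rule int[OF continuous_on_id])
  then have "d = (\<integral>v. d + p \<bullet> (v - Q) \<partial>\<tau>)"
    using \<tau>(5) by (simp add: \<tau>.prob_space inner_diff_right)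
  also have "\<dots> \<le> (\<integral>v. f v \<partial>\<tau>)"
  proof (rule integral_mono_AE)
    show "integrable \<tau> (\<lambda>v. d + p \<bullet> (v - Q))"
      by (rule int) (intro continuous_intros)
    show "AE v in \<tau>. d + p \<bullet> (v - Q) \<le> f v"
      using \<tau>(3) by eventually_elim (use p in auto)
  qed (rule int[OF cf])
  finally have "d \<le> (\<integral>v. f v \<partial>\<tau>)" .
  moreover have "(\<integral>v. f v \<partial>\<tau>) \<le> (\<integral>v. g v + K \<partial>\<tau>)"
    using int[OF cf] int[OF cg] le by (intro integral_mono) auto
  moreover have "(\<integral>v. g v + K \<partial>\<tau>) = e + K"
    using int[OF cg] \<tau>(6) by (simp add: \<tau>.prob_space)
  ultimately show "(\<integral>v. f v \<partial>\<tau>) \<le> e + K" "d \<le> e + K" by auto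
qed

section \<open>The minimax measure\<close>

lemma cover_index:
  fixes \<delta> :: real
  assumes "\<delta> > 0"
  obtains cs :: "(real^'n) list" and idx :: "'n::finite torus \<Rightarrow> nat"
  where "idx \<in> borel \<rightarrow>\<^sub>M count_space UNIV" "\<And>x. idx x < length cs"
    "\<And>x. dist (cs ! idx x) (torus_rep x) < \<delta>"
proof -
  obtain k where k: "finite k" "cbox (0::real^'n) 1 \<subseteq> (\<Union>c\<in>k. ball c \<delta>)"
    using compact_cbox[of "0::real^'n" 1] assms unfolding compact_eq_totally_bounded by blast
  obtain cs where cs: "set cs = k" using finite_list[OF k(1)] by blast
  let ?P = "\<lambda>x i. i < length cs \<and> dist (cs ! i) (torus_rep x) < \<delta>"
  define idx where "idx x = (LEAST i. ?P x i)" for x :: "'n torus"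
  have "\<exists>i. ?P x i" for x :: "'n torus"
  proof -
    have "torus_rep x \<in> (\<Union>c\<in>k. ball c \<delta>)" using k(2) torus_rep_bounds by blast
    then show ?thesis using cs by (auto simp: in_set_conv_nth)
  qed
  then have "?P x (idx x)" for x unfolding idx_def by (rule LeastI_ex)
  moreover have "idx \<in> borel \<rightarrow>\<^sub>M count_space UNIV"
    unfolding idx_def[abs_def] by measurable
  ultimately show thesis using that by blast
qed

lemma differentiable_of_smooth: "smooth f \<Longrightarrow> f differentiable (at x)"
  unfolding smooth_def using C_k.simps(2)[of 0 f] by blast

theorem mainTheorem1:
  fixes L :: "'n::finite torus \<Rightarrow> real^'n \<Rightarrow> real" and \<gamma> C :: real and Q :: "real^'n"
  assumes smooth: "smooth (\<lambda>(x, v). lift_lagrangian L x v)"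
    and strictly_convex: "\<And>x u v t. u \<noteq> v \<Longrightarrow> 0 < t \<Longrightarrow> t < 1 \<Longrightarrow>
          L x ((1 - t) *\<^sub>R u + t *\<^sub>R v) < (1 - t) * L x u + t * L x v"
    and gamma_pos: "\<gamma> > 0"
    and D2vv: "\<And>x v h. second_derivative (L x) v h h \<ge> \<gamma> * (norm h)\<^sup>2"
    and coercive: "\<And>x. filterlim (\<lambda>v. L x v / norm v) at_top at_infinity"
    and Dx: "\<And>x v. onorm (frechet_derivative (\<lambda>y. lift_lagrangian L y v) (at x)) \<le> C"
    and D2xx: "\<And>x v h k. \<bar>second_derivative (\<lambda>y. lift_lagrangian L y v) x h k\<bar> \<le> C * norm h * norm k"
  shows "\<exists>\<theta> \<pi>. \<theta> \<in> space (prob_algebra borel) \<and> \<pi> \<in> plans \<theta> Q \<and>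
    (\<forall>\<pi>' \<in> plans \<theta> Q. action L (plan_measure \<theta> \<pi>) \<le> action L (plan_measure \<theta> \<pi>')) \<and>
    (\<forall>\<theta>' \<in> space (prob_algebra borel).
       action L (plan_measure \<theta> \<pi>) \<ge> (INF \<pi>' \<in> plans \<theta>' Q. action L (plan_measure \<theta>' \<pi>')))"
proof -
  let ?l = "\<lambda>(x, v). lift_lagrangian L x v"
  have diff: "?l differentiable (at z)" for z by (rule differentiable_of_smooth[OF smooth])
  have contL: "continuous_on UNIV (\<lambda>(y, v). L (torus_proj y) v)"
    using smooth unfolding smooth_def lift_lagrangian_def[abs_def]
    by (auto dest!: spec[of _ 0])
  have cont_fiber: "continuous_on UNIV (L x)" for x
  proof -
    have "continuous_on UNIV (\<lambda>v. case (torus_rep x, v) of (y, v) \<Rightarrow> L (torus_proj y) v)"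
      by (rule continuous_on_compose2[OF contL]) (auto intro!: continuous_intros)
    then show ?thesis by simp
  qed
  have lip: "L (torus_proj y) v \<le> L (torus_proj z) v + C * dist y z" for y z v
  proof -
    have "(\<lambda>y. lift_lagrangian L y v) differentiable (at x)" for x
      using differentiable_chain_at[of "\<lambda>y. (y, v)" x ?l] diff
      by (simp add: o_def differentiable_Pair)
    then have "norm (lift_lagrangian L y v - lift_lagrangian L z v) \<le> C * norm (y - z)"
      by (intro differentiable_bound[OF convex_UNIV, of _
            "\<lambda>x. frechet_derivative (\<lambda>y. lift_lagrangian L y v) (at x)"])
        (auto simp: frechet_derivative_works[symmetric] Dx)
    then show ?thesis by (simp add: lift_lagrangian_def dist_norm)
  qed
  \<comment> \<open>Add the Lipschitz bounds in both directions between two distinct points.\<close>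
  have "0 \<le> C * dist (0::real^'n) 1"
    using lip[of 0 0 1] lip[of 1 0 0] by (simp add: dist_commute)
  then have "C \<ge> 0" by (simp add: zero_le_mult_iff)
  have "\<exists>\<sigma> d. fiber_minimizer (L x) Q \<sigma> d" for x
    by (rule fiber_minimizer_exists[OF cont_fiber coercive])
  then obtain \<sigma> G where \<sigma>: "\<And>x. fiber_minimizer (L x) Q (\<sigma> x) (G x)" by metis
  have \<sigma>_props: "\<sigma> x \<in> space (prob_algebra borel)" "AE v in \<sigma> x. v \<in> integer_vectors"
    "(\<integral>v. v \<partial>\<sigma> x) = Q" "(\<integral>v. L x v \<partial>\<sigma> x) = G x" for x
    using \<sigma>[of x] by (auto simp: fiber_minimizer_def)
  have "\<forall>x. \<exists>R. AE v in \<sigma> x. norm v \<le> R" using \<sigma> by (auto simp: fiber_minimizer_def)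
  then obtain R where R: "\<And>x. AE v in \<sigma> x. norm v \<le> R x" by metis
  note compare = fiber_minimizer_integral_le[OF \<sigma> \<sigma> cont_fiber cont_fiber lip]
  have "\<bar>G (torus_proj y) - G (torus_proj z)\<bar> \<le> C * dist y z" for y z
    using compare(1)[of y z] compare(1)[of z y] by (simp add: dist_commute abs_le_iff)
  then have "C-lipschitz_on UNIV (\<lambda>y. G (torus_proj y))"
    using \<open>C \<ge> 0\<close> by (intro lipschitz_onI) (auto simp: dist_real_def)
  then have "continuous_on (cbox 0 1) (\<lambda>y. G (torus_proj y))"
    using lipschitz_on_continuous_on continuous_on_subset by blast
  moreover have "(0::real^'n) \<in> cbox 0 1" by (simp add: mem_box_cart)
  ultimately obtain y0 where y0: "\<forall>y\<in>cbox 0 1. G (torus_proj y) \<le> G (torus_proj y0)"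
    using continuous_attains_sup[OF compact_cbox] by blast
  define x0 where "x0 = torus_proj y0"
  have G_max: "G x \<le> G x0" for x
    using y0[rule_format, OF torus_rep_bounds, of x] by (simp add: x0_def)
  have plan: "\<pi> \<in> plans \<theta> Q" "action L (plan_measure \<theta> \<pi>) = ereal (\<integral>x. (\<integral>v. L x v \<partial>\<pi> x) \<partial>\<theta>)"
    if \<theta>: "\<theta> \<in> space (prob_algebra borel)" and \<pi>: "\<pi> \<in> borel \<rightarrow>\<^sub>M prob_algebra borel"
      and ex: "\<And>x. \<exists>y. \<pi> x = \<sigma> y \<and> R y \<le> r" for \<theta> \<pi> r
  proof -
    have bd: "AE v in \<pi> x. norm v \<le> r" for x
    proof -
      obtain y where y: "\<pi> x = \<sigma> y" "R y \<le> r" using ex by blast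
      show ?thesis unfolding y(1) using R[of y] by eventually_elim (use y(2) in simp)
    qed
    have "AE v in \<pi> x. v \<in> integer_vectors" "(\<integral>v. v \<partial>\<pi> x) = Q" for x
    proof -
      obtain y where y: "\<pi> x = \<sigma> y" using ex by blast
      show "AE v in \<pi> x. v \<in> integer_vectors" "(\<integral>v. v \<partial>\<pi> x) = Q"
        unfolding y by (rule \<sigma>_props(2), rule \<sigma>_props(3))
    qed
    then show "\<pi> \<in> plans \<theta> Q" by (intro integer_kernel_in_plans[OF \<theta> \<pi> _ bd])
    show "action L (plan_measure \<theta> \<pi>) = ereal (\<integral>x. (\<integral>v. L x v \<partial>\<pi> x) \<partial>\<theta>)"
      unfolding action_def
      using plan_integral(1,2)[OF \<theta> \<pi> bd contL] by (simp add: ext_integral_integrable)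
  qed
  define \<theta> where "\<theta> = return borel x0"
  define \<pi> where "\<pi> = (\<lambda>x::'n torus. \<sigma> x0)"
  have \<theta>: "\<theta> \<in> space (prob_algebra borel)"
    by (simp add: \<theta>_def space_prob_algebra prob_space_return)
  have \<pi>: "\<pi> \<in> borel \<rightarrow>\<^sub>M prob_algebra borel"
    unfolding \<pi>_def using \<sigma>_props(1) by (intro measurable_const)
  note opt = plan[OF \<theta> \<pi>, of "R x0"]
  have \<pi>_plan: "\<pi> \<in> plans \<theta> Q" by (rule opt(1)) (auto simp: \<pi>_def)
  have action_opt: "action L (plan_measure \<theta> \<pi>) = ereal (G x0)"
  proof -
    have "AE v in \<pi> x. norm v \<le> R x0" for x unfolding \<pi>_def by (rule R)
    from plan_integral(3)[OF \<theta> \<pi> this contL]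
    have "integrable \<theta> (\<lambda>x. \<integral>v. L x v \<partial>\<pi> x)" .
    from borel_measurable_integrable[OF this]
    have meas: "(\<lambda>x. \<integral>v. L x v \<partial>\<pi> x) \<in> borel_measurable borel"
      unfolding \<theta>_def measurable_return1 .
    have "(\<integral>x. (\<integral>v. L x v \<partial>\<pi> x) \<partial>\<theta>) = (\<integral>v. L x0 v \<partial>\<pi> x0)"
      unfolding \<theta>_def by (rule integral_return[OF _ meas]) simp
    also have "\<dots> = G x0" unfolding \<pi>_def by (rule \<sigma>_props(4))
    finally have "(\<integral>x. (\<integral>v. L x v \<partial>\<pi> x) \<partial>\<theta>) = G x0" .
    moreover have "\<exists>y. \<pi> x = \<sigma> y \<and> R y \<le> R x0" for x
      unfolding \<pi>_def by (intro exI[of _ x0]) simp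
    ultimately show ?thesis using opt(2) by (simp only:)
  qed
  have min: "action L (plan_measure \<theta> \<pi>) \<le> action L (plan_measure \<theta> \<pi>')" if "\<pi>' \<in> plans \<theta> Q" for \<pi>'
  proof -
    obtain p where p: "\<forall>v\<in>integer_vectors. G x0 + p \<bullet> (v - Q) \<le> L x0 v"
      using \<sigma>[of x0] by (auto simp: fiber_minimizer_def)
    have "ereal (G x0) \<le> action L (plan_measure \<theta> \<pi>')"
      using dirac_action_ge[OF that[unfolded \<theta>_def] borel_measurable_lift[OF contL] p[rule_format]]
      unfolding \<theta>_def .
    then show ?thesis by (simp only: action_opt)
  qed
  have "(INF \<pi>' \<in> plans \<theta>' Q. action L (plan_measure \<theta>' \<pi>')) \<le> ereal (G x0)"
    if \<theta>': "\<theta>' \<in> space (prob_algebra borel)" for \<theta>'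
  proof (rule ereal_le_epsilon2)
    fix e :: real assume "e > 0"
    interpret \<theta>': prob_space \<theta>' using \<theta>' by (simp add: space_prob_algebra)
    \<comment> \<open>Division by \<open>C + 1\<close> because \<open>C\<close> may be zero.\<close>
    define \<delta> where "\<delta> = e / (C + 1)"
    have "\<delta> > 0" "C * \<delta> \<le> e" using \<open>e > 0\<close> \<open>C \<ge> 0\<close> by (auto simp: \<delta>_def field_simps)
    obtain cs :: "(real^'n) list" and idx :: "'n torus \<Rightarrow> nat" where
      idx: "idx \<in> borel \<rightarrow>\<^sub>M count_space UNIV" "\<And>x. idx x < length cs"
        "\<And>x. dist (cs ! idx x) (torus_rep x) < \<delta>"
      by (rule cover_index[OF \<open>\<delta> > 0\<close>], rule that)
    define c where "c x = torus_proj (cs ! idx x)" for x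
    define \<pi>' where "\<pi>' x = \<sigma> (c x)" for x
    have \<pi>': "\<pi>' \<in> borel \<rightarrow>\<^sub>M prob_algebra borel"
      unfolding \<pi>'_def[abs_def] c_def using \<sigma>_props(1)
      by (intro measurable_compose[OF idx(1)]) auto
    define r where "r = Max ((\<lambda>y. R (torus_proj y)) ` set cs)"
    have r: "R (c x) \<le> r" for x
      unfolding r_def c_def using idx(2) by (intro Max_ge) auto
    have ex: "\<exists>y. \<pi>' x = \<sigma> y \<and> R y \<le> r" for x
      using r by (auto simp: \<pi>'_def)
    have bd: "AE v in \<pi>' x. norm v \<le> r" for x
      unfolding \<pi>'_def using R[of "c x"] by eventually_elim (use r[of x] in simp)
    have "(\<integral>v. L x v \<partial>\<pi>' x) \<le> G x0 + e" for x
    proof -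
      have "(\<integral>v. L x v \<partial>\<pi>' x) \<le> G (c x) + C * dist (torus_rep x) (cs ! idx x)"
        using compare(2)[of "cs ! idx x" "torus_rep x"] by (simp add: \<pi>'_def c_def)
      also have "C * dist (torus_rep x) (cs ! idx x) \<le> C * \<delta>"
        using idx(3)[of x] \<open>C \<ge> 0\<close> by (intro mult_left_mono) (auto simp: dist_commute)
      finally show ?thesis using G_max[of "c x"] \<open>C * \<delta> \<le> e\<close> by linarith
    qed
    then have "(\<integral>x. (\<integral>v. L x v \<partial>\<pi>' x) \<partial>\<theta>') \<le> G x0 + e"
      by (intro \<theta>'.integral_le_const plan_integral(3)[OF \<theta>' \<pi>' bd contL] AE_I2)
    then have "action L (plan_measure \<theta>' \<pi>') \<le> ereal (G x0) + ereal e"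
      using plan(2)[OF \<theta>' \<pi>' ex] by simp
    then show "(INF \<pi>' \<in> plans \<theta>' Q. action L (plan_measure \<theta>' \<pi>')) \<le> ereal (G x0) + ereal e"
      using plan(1)[OF \<theta>' \<pi>' ex] by (rule INF_lower2[rotated])
  qed
  then have "(INF \<pi>' \<in> plans \<theta>' Q. action L (plan_measure \<theta>' \<pi>')) \<le> action L (plan_measure \<theta> \<pi>)"
    if "\<theta>' \<in> space (prob_algebra borel)" for \<theta>'
    using that by (simp only: action_opt)
  then show ?thesis
    using \<theta> \<pi>_plan min by (intro exI[of _ \<theta>] exI[of _ \<pi>] conjI ballI)
qed

end
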